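(* Let $G=(V,E)$ be a graph on $n$ vertices, $\alpha>0$, and $\vec p\in\mathbb{C}^V$ with $(1+\alpha)^2\vec p\in\mathcal{S}$. Fix a root pair $(A,a)$ with $A\subseteq V$, $a\in A$, and an integer $\ell\ge0$, and consider the computation tree of depth $\ell$ rooted at $(A,a)$ with estimates $R$. Then for every node $(S,u)$ of this tree at depth $\delta(S,u)\le\ell$, $$|r_{S,u}(\vec p)-R_{S,u}|\le\sqrt{\beta_{S,u}(\vec p)\,\beta_{S,u}((1+\alpha)\vec p)}\,(1+\sqrt{\alpha})^{-(\ell-\delta(S,u))/2}.$$
   Context: For $S\subseteq V$ and $\vec q\in\mathbb{C}^V$, $\breve q_S(\vec q)=\sum_{I\subseteq S,\ I\text{ independent in }G}(-1)^{|I|}\prod_{v\in I}q_v$. The complex Shearer region is $\mathcal{S}=\{\vec q\in\mathbb{C}^V : Z_G(\vec z)\neq0 \ \forall\vec z\in\mathbb{C}^V \text{ with }|z_v|\le|q_v|\ \forall v\}$, where $Z_G(\vec z)=\sum_{I\text{ indep.}}\prod_{v\in I}z_v$ (so $\breve q_V(\vec q)=Z_G(-\vec q)$). For $u\in S\subseteq V$, the occupation ratio is $r_{S,u}(\vec q)=1-\breve q_S(\vec q)/\breve q_{S\setminus\{u\}}(\vec q)$, and $\varrho_{S,u}(\vec q)=r_{S,u}(|\vec q|)$ where $|\vec q|$ is the vector of coordinate-wise absolute values. The error sensitivity parameter is $\beta_{S,u}(\vec q)=\frac{d}{dt}\varrho_{S,u}((1+t)\vec q)\big|_{t=0}$. Children: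 for a pair $(S,u)$, fix an arbitrary ordering $(w_1,\dots,w_k)$ of $\Gamma(u)\cap S$ ($\Gamma(u)$ = neighbours of $u$ in $G$); the children of $(S,u)$ are $(S\setminus\{u,w_1,\dots,w_{i-1}\},w_i)$ for $i=1,\dots,k$. The computation tree rooted at $(A,a)$ is obtained by recursively attaching children; the depth $\delta$ of a node is its distance from the root. The estimates are defined on nodes of depth $\le\ell$ by $R_{S,u}=0$ if $\delta(S,u)=\ell$, and otherwise $R_{S,u}=p_u\prod_{c}(1-R_c)^{-1}$, the product over the children $c$ of $(S,u)$. *)

theory Defs
  imports "HOL-Analysis.Analysis" "Graph_Theory.Pair_Digraph"
begin

(* A finite simple graph is a "pair_graph" G: vertex set pverts G, and each edge {u, v} is
   represented by the two arcs (u, v), (v, u) in parcs G.  A vector in C^V is a function on the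
   vertex type; only its values on V = pverts G matter. *)

definition indep_set :: "'a pair_pre_digraph \<Rightarrow> 'a set \<Rightarrow> bool" where
  "indep_set G I \<longleftrightarrow> I \<subseteq> pverts G \<and> (\<forall>u\<in>I. \<forall>v\<in>I. (u, v) \<notin> parcs G)"

definition nbrs :: "'a pair_pre_digraph \<Rightarrow> 'a \<Rightarrow> 'a set" where
  "nbrs G u = {v \<in> pverts G. (u, v) \<in> parcs G}"

definition indep_poly :: "'a pair_pre_digraph \<Rightarrow> ('a \<Rightarrow> complex) \<Rightarrow> complex" where
  "indep_poly G z = (\<Sum>I | indep_set G I. \<Prod>v\<in>I. z v)"

(* Polymorphic in the scalars: used over the complex numbers for occ_ratio at q, and over the
   reals for occ_ratio at |q|. *)
definition q_breve :: "'a pair_pre_digraph \<Rightarrow> 'a set \<Rightarrow> ('a \<Rightarrow> 'b) \<Rightarrow> 'b::field" where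
  "q_breve G S q = (\<Sum>I | I \<subseteq> S \<and> indep_set G I. (- 1) ^ card I * (\<Prod>v\<in>I. q v))"

definition shearer_region :: "'a pair_pre_digraph \<Rightarrow> ('a \<Rightarrow> complex) set" where
  "shearer_region G =
     {q. \<forall>z :: 'a \<Rightarrow> complex. (\<forall>v\<in>pverts G. cmod (z v) \<le> cmod (q v)) \<longrightarrow> indep_poly G z \<noteq> 0}"

definition occ_ratio :: "'a pair_pre_digraph \<Rightarrow> 'a set \<Rightarrow> 'a \<Rightarrow> ('a \<Rightarrow> 'b) \<Rightarrow> 'b::field" where
  "occ_ratio G S u q = 1 - q_breve G S q / q_breve G (S - {u}) q"

definition abs_occ_ratio :: "'a pair_pre_digraph \<Rightarrow> 'a set \<Rightarrow> 'a \<Rightarrow> ('a \<Rightarrow> complex) \<Rightarrow> real" where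
  "abs_occ_ratio G S u q = occ_ratio G S u (\<lambda>v. cmod (q v))"

definition err_sens :: "'a pair_pre_digraph \<Rightarrow> 'a set \<Rightarrow> 'a \<Rightarrow> ('a \<Rightarrow> complex) \<Rightarrow> real" where
  "err_sens G S u q =
     deriv (\<lambda>t::real. abs_occ_ratio G S u (\<lambda>v. complex_of_real (1 + t) * q v)) 0"

(* A choice, for every pair (S, u), of an enumeration without repetition of the neighbours of u
   in S. *)
definition nbr_ordering :: "'a pair_pre_digraph \<Rightarrow> ('a set \<Rightarrow> 'a \<Rightarrow> 'a list) \<Rightarrow> bool" where
  "nbr_ordering G ws \<longleftrightarrow>
     (\<forall>S u. S \<subseteq> pverts G \<and> u \<in> S \<longrightarrow> distinct (ws S u) \<and> set (ws S u) = nbrs G u \<inter> S)"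

(* List positions count from 0, so the i-th entry is the child with vertex w_(i+1), and
   take i yields w_1, ..., w_i. *)
definition children :: "('a set \<Rightarrow> 'a \<Rightarrow> 'a list) \<Rightarrow> 'a set \<Rightarrow> 'a \<Rightarrow> ('a set \<times> 'a) list" where
  "children ws S u =
     map (\<lambda>i. (S - insert u (set (take i (ws S u))), ws S u ! i)) [0..<length (ws S u)]"

(* tree_node ws A a d S u: the computation tree rooted at (A, a) has a node at depth d labelled
   (S, u).  The same pair may occur at several depths, so the depth is part of the data; the pair
   and the depth together determine the subtree below the node. *)
inductive tree_node :: "('a set \<Rightarrow> 'a \<Rightarrow> 'a list) \<Rightarrow> 'a set \<Rightarrow> 'a \<Rightarrow> nat \<Rightarrow> 'a set \<Rightarrow> 'a \<Rightarrow> bool"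
  for ws A a where
  root: "tree_node ws A a 0 A a"
| child: "tree_node ws A a d S u \<Longrightarrow> (T, w) \<in> set (children ws S u) \<Longrightarrow>
    tree_node ws A a (Suc d) T w"

(* estimate ws p l d S u: the estimate R at a node of depth d labelled (S, u), in the tree cut
   off at depth l.  Only d \<le> l is meaningful. *)
function estimate ::
  "('a set \<Rightarrow> 'a \<Rightarrow> 'a list) \<Rightarrow> ('a \<Rightarrow> complex) \<Rightarrow> nat \<Rightarrow> nat \<Rightarrow> 'a set \<Rightarrow> 'a \<Rightarrow> complex" where
  "estimate ws p l d S u =
     (if d \<ge> l then 0
      else p u * (\<Prod>(T, w)\<leftarrow>children ws S u. inverse (1 - estimate ws p l (Suc d) T w)))"
  by pat_completeness auto
termination
  by (relation "Wellfounded.measure (\<lambda>(ws, p, l, d, S, u). l - d)") auto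

declare estimate.simps [simp del]

end

(* For real weights q = s|p| the occupation ratios satisfy rho = q_u prod_c 1/(1 - rho_c) over
   the children c, so logarithmic differentiation in s gives beta = rho (1 + sum_c beta_c/(1 - rho_c)),
   while the errors e satisfy e <= rho sum_c e_c/(1 - rho_c).  By Cauchy-Schwarz the weight
   sqrt(beta(p) beta((1 + alpha)p)) propagates down the tree, and the gain per level comes from
   rho((1 + alpha)p) >= rho(p) + alpha beta(p): each rho is a convex function of the scale s. *)
theory Submission
  imports Defs
begin

section \<open>Children of a node and the recursion for the occupation ratios\<close>

definition child_set :: "('a set \<Rightarrow> 'a \<Rightarrow> 'a list) \<Rightarrow> 'a set \<Rightarrow> 'a \<Rightarrow> nat \<Rightarrow> 'a set" where
  "child_set ws S u i = S - insert u (set (take i (ws S u)))"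

lemma children_conv:
  "children ws S u = map (\<lambda>i. (child_set ws S u i, ws S u ! i)) [0..<length (ws S u)]"
  by (simp add: children_def child_set_def)

lemma nbr_orderingD:
  assumes "nbr_ordering G ws" "S \<subseteq> pverts G" "u \<in> S"
  shows "distinct (ws S u)" "set (ws S u) = nbrs G u \<inter> S"
  using assms by (auto simp: nbr_ordering_def)

lemma child_set_0 [simp]: "child_set ws S u 0 = S - {u}"
  by (simp add: child_set_def)

text \<open>Consecutive sets differ by exactly the vertex of the child between them, so
  \<open>1 - occ_ratio\<close> of that child is a quotient of neighbouring values of
  \<open>q_breve\<close>.\<close>

lemma child_set_Suc:
  assumes "i < length (ws S u)"
  shows "child_set ws S u (Suc i) = child_set ws S u i - {ws S u ! i}"
  using assms by (auto simp: child_set_def take_Suc_conv_app_nth)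

text \<open>The index one past the last child is included on purpose: its set, S without the closed
  neighbourhood of u, is the far end of the telescoping product in
  \<open>occ_ratio_rec\<close>.\<close>

lemma child_set_last:
  assumes "nbr_ordering G ws" "S \<subseteq> pverts G" "u \<in> S"
  shows "child_set ws S u (length (ws S u)) = S - insert u (nbrs G u)"
  using nbr_orderingD[OF assms] by (auto simp: child_set_def)

context pair_graph
begin

lemma not_mem_nbrs: "u \<notin> nbrs G u"
  using pair_no_loops[of "(u, u)"] by (auto simp: nbrs_def)

text \<open>The enumeration has no repetitions and u has no loop, so the vertex of a child survives
  in its set. The set itself loses u, and this strict decrease drives
  \<open>child_induct\<close>.\<close>

lemma child_props:
  assumes "nbr_ordering G ws" "S \<subseteq> pverts G" "u \<in> S" "i < length (ws S u)"
  shows "child_set ws S u i \<subseteq> pverts G" "ws S u ! i \<in> child_set ws S u i"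
    "child_set ws S u i \<subset> S"
proof -
  note o = nbr_orderingD[OF assms(1-3)]
  have m: "ws S u ! i \<in> nbrs G u \<inter> S" using o(2) assms(4) nth_mem by blast
  have "ws S u ! i \<notin> set (take i (ws S u))"
    using o(1) assms(4) by (auto simp: in_set_conv_nth nth_eq_iff_index_eq)
  then show "ws S u ! i \<in> child_set ws S u i"
    using m not_mem_nbrs[of u] by (auto simp: child_set_def)
  show "child_set ws S u i \<subset> S" "child_set ws S u i \<subseteq> pverts G"
    using assms(2,3) by (auto simp: child_set_def)
qed

lemma finite_subset_verts: "S \<subseteq> pverts G \<Longrightarrow> finite S"
  using pair_finite_verts finite_subset by blast

text \<open>Children live on strictly smaller finite sets, so induction over the full recursion tree
  is induction on S, independent of root and depth.\<close>

lemma child_induct [consumes 3, case_names node]: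
  assumes "nbr_ordering G ws" "S \<subseteq> pverts G" "u \<in> S"
    and step: "\<And>S u. S \<subseteq> pverts G \<Longrightarrow> u \<in> S \<Longrightarrow>
      (\<And>i. i < length (ws S u) \<Longrightarrow> P (child_set ws S u i) (ws S u ! i)) \<Longrightarrow> P S u"
  shows "P S u"
  using finite_subset_verts[OF assms(2)] assms(2,3)
proof (induction S arbitrary: u rule: finite_psubset_induct)
  case (psubset S)
  show ?case
  proof (rule step[OF psubset.prems])
    fix i assume "i < length (ws S u)"
    with child_props[OF assms(1) psubset.prems this]
    show "P (child_set ws S u i) (ws S u ! i)" by (intro psubset.IH) auto
  qed
qed

text \<open>Independent subsets of S either avoid u or have the form \<open>insert u J\<close> with
  J independent and outside the closed neighbourhood of u. Adding u contributes the factor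
  \<open>- q u\<close>.\<close>

lemma q_breve_split:
  assumes "S \<subseteq> pverts G" "u \<in> S"
  shows "q_breve G S q = q_breve G (S - {u}) q - q u * q_breve G (S - insert u (nbrs G u)) q"
proof -
  let ?f = "\<lambda>I. (- 1) ^ card I * (\<Prod>v\<in>I. q v)"
  let ?A = "\<lambda>T. {I. I \<subseteq> T \<and> indep_set G I}"
  let ?T = "S - insert u (nbrs G u)"
  have fin: "finite (?A T)" if "T \<subseteq> S" for T
    using finite_subset_verts[of T] that assms(1) by auto
  have A: "?A S = ?A (S - {u}) \<union> insert u ` ?A ?T"
  proof (intro equalityI subsetI)
    fix I assume I: "I \<in> ?A S"
    show "I \<in> ?A (S - {u}) \<union> insert u ` ?A ?T"
    proof (cases "u \<in> I")
      case True
      have "I - {u} \<in> ?A ?T" using I True by (auto simp: indep_set_def nbrs_def)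
      moreover have "I = insert u (I - {u})" using True by auto
      ultimately show ?thesis by (intro UnI2 image_eqI)
    qed (use I in auto)
  next
    fix I assume "I \<in> ?A (S - {u}) \<union> insert u ` ?A ?T"
    then consider "I \<in> ?A (S - {u})" | J where "I = insert u J" "J \<in> ?A ?T"
      by (elim UnE imageE)
    then show "I \<in> ?A S"
    proof cases
      case 2
      \<comment> \<open>\<open>nbrs\<close> records only arcs leaving u; symmetry of the arc set
        excludes those entering u.\<close>
      have "(u, v) \<notin> parcs G \<and> (v, u) \<notin> parcs G" if "v \<in> J" for v
      proof -
        have "v \<in> pverts G" "v \<notin> nbrs G u" using 2 that assms by auto
        then show ?thesis using arcs_symmetric[of v u] by (auto simp: nbrs_def)
      qed
      moreover have "(u, u) \<notin> parcs G" using pair_no_loops[of "(u, u)"] by auto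
      ultimately show ?thesis using 2 assms by (auto simp: indep_set_def)
    qed auto
  qed
  have inj: "inj_on (insert u) (?A ?T)"
  proof (rule inj_onI)
    fix J K assume "J \<in> ?A ?T" "K \<in> ?A ?T" and eq: "insert u J = insert u K"
    then have "u \<notin> J" "u \<notin> K" by auto
    with eq show "J = K" by (simp add: insert_ident)
  qed
  have step: "?f (insert u J) = - q u * ?f J" if "J \<in> ?A ?T" for J
  proof -
    have "finite J" "u \<notin> J" using that finite_subset_verts[of J] by (auto simp: indep_set_def)
    then show ?thesis by simp
  qed
  have "sum ?f (?A S) = sum ?f (?A (S - {u})) + sum ?f (insert u ` ?A ?T)"
    unfolding A by (rule sum.union_disjoint) (use fin in auto)
  also have "sum ?f (insert u ` ?A ?T) = (\<Sum>J\<in>?A ?T. - q u * ?f J)"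
    unfolding sum.reindex[OF inj] o_def by (rule sum.cong) (use step in auto)
  finally show ?thesis
    unfolding q_breve_def by (simp add: sum_distrib_left sum_negf)
qed

text \<open>The factor of child i is the quotient of \<open>q_breve\<close> at the child sets i + 1
  and i. The product telescopes, and \<open>q_breve_split\<close> identifies what remains. The
  scalar field stays general because the recursion serves both complex p and the real vectors
  s|p|.\<close>

lemma occ_ratio_rec:
  assumes ord: "nbr_ordering G ws" and S: "S \<subseteq> pverts G" "u \<in> S"
    and nz: "\<And>T. T \<subseteq> pverts G \<Longrightarrow> q_breve G T q \<noteq> 0"
  shows "occ_ratio G S u q =
    q u * (\<Prod>i<length (ws S u). inverse (1 - occ_ratio G (child_set ws S u i) (ws S u ! i) q))"
proof -
  let ?k = "length (ws S u)" and ?g = "\<lambda>i. q_breve G (child_set ws S u i) q"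
  have sub: "child_set ws S u i \<subseteq> pverts G" for i using S by (auto simp: child_set_def)
  have "(\<Prod>i<?k. inverse (1 - occ_ratio G (child_set ws S u i) (ws S u ! i) q)) =
      (\<Prod>i<?k. ?g (Suc i) / ?g i)"
    by (rule prod.cong) (simp_all add: occ_ratio_def child_set_Suc)
  also have "\<dots> = ?g ?k / ?g 0" by (rule prod_lessThan_telescope) (use nz sub in auto)
  finally have P: "(\<Prod>i<?k. inverse (1 - occ_ratio G (child_set ws S u i) (ws S u ! i) q)) =
    q_breve G (S - insert u (nbrs G u)) q / q_breve G (S - {u}) q"
    by (simp add: child_set_last[OF ord S])
  have "q_breve G (S - {u}) q \<noteq> 0" using S by (intro nz) auto
  then show ?thesis unfolding P using q_breve_split[OF S, of q]
    by (simp add: occ_ratio_def field_simps)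
qed

end

section \<open>Nonvanishing and positivity in the Shearer region\<close>

lemma q_breve_of_real:
  "q_breve G S (\<lambda>v. complex_of_real (y v)) = complex_of_real (q_breve G S y)"
  by (simp add: q_breve_def)

lemma q_breve_zero:
  assumes "finite S"
  shows "q_breve G S (\<lambda>v. 0 :: 'b) = (1 :: 'b :: field)"
proof -
  have fin: "finite {I. I \<subseteq> S \<and> indep_set G I}" using assms by auto
  have "q_breve G S (\<lambda>v. 0 :: 'b) = (\<Sum>I | I \<subseteq> S \<and> indep_set G I. if I = {} then 1 else 0)"
    unfolding q_breve_def
  proof (rule sum.cong[OF refl])
    fix I assume "I \<in> {I. I \<subseteq> S \<and> indep_set G I}"
    then have "finite I" using assms finite_subset by auto
    then show "(- 1) ^ card I * (\<Prod>v\<in>I. (0::'b)) = (if I = {} then 1 else 0)" by auto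
  qed
  also have "\<dots> = 1" using fin by (simp add: sum.delta indep_set_def)
  finally show ?thesis .
qed

text \<open>Extending -y from S by zero turns \<open>indep_poly\<close> into
  \<open>q_breve G S y\<close>, because sets leaving S contribute nothing. The extended vector is
  dominated by q, so the region forbids a zero.\<close>

lemma q_breve_nonzero:
  assumes fin: "finite (pverts G)" and q: "q \<in> shearer_region G" and S: "S \<subseteq> pverts G"
    and le: "\<And>v. v \<in> pverts G \<Longrightarrow> cmod (y v) \<le> cmod (q v)"
  shows "q_breve G S y \<noteq> 0"
proof -
  let ?z = "\<lambda>v. if v \<in> S then - y v else 0"
  have f: "finite I" if "indep_set G I" for I
    using that fin finite_subset by (auto simp: indep_set_def)
  have "indep_poly G ?z = q_breve G S y"
    unfolding indep_poly_def q_breve_def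
  proof (rule sum.mono_neutral_cong_right)
    show "finite {I. indep_set G I}"
      by (rule finite_subset[of _ "Pow (pverts G)"]) (use fin in \<open>auto simp: indep_set_def\<close>)
    show "\<forall>I\<in>{I. indep_set G I} - {I. I \<subseteq> S \<and> indep_set G I}. prod ?z I = 0"
      using f by (auto intro!: prod_zero)
    fix I assume I: "I \<in> {I. I \<subseteq> S \<and> indep_set G I}"
    have "prod ?z I = (\<Prod>v\<in>I. (- 1) * y v)" using I by (intro prod.cong) auto
    also have "\<dots> = (- 1) ^ card I * (\<Prod>v\<in>I. y v)" by (subst prod.distrib) simp
    finally show "prod ?z I = (- 1) ^ card I * (\<Prod>v\<in>I. y v)" .
  qed auto
  moreover have "indep_poly G ?z \<noteq> 0"
    using q le unfolding shearer_region_def by auto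
  ultimately show ?thesis by simp
qed

text \<open>At scale 0 the value is 1. A nonpositive value at s would force a zero at some scale in
  between by the intermediate value theorem, against \<open>q_breve_nonzero\<close>.\<close>

lemma q_breve_pos:
  assumes fin: "finite (pverts G)" and q: "(\<lambda>v. complex_of_real M * p v) \<in> shearer_region G"
    and S: "S \<subseteq> pverts G" and s: "0 \<le> s" "s \<le> M"
  shows "q_breve G S (\<lambda>v. s * cmod (p v)) > 0"
proof (rule ccontr)
  assume neg: "\<not> ?thesis"
  let ?f = "\<lambda>s. q_breve G S (\<lambda>v. s * cmod (p v))"
  have "continuous_on {0..s} ?f" unfolding q_breve_def by (intro continuous_intros)
  moreover have "?f 0 = 1" using q_breve_zero[of S G] S fin finite_subset by auto
  ultimately obtain t where t: "0 \<le> t" "t \<le> s" "?f t = 0"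
    using IVT2'[of ?f s 0 0] neg s by auto
  have "q_breve G S (\<lambda>v. complex_of_real (t * cmod (p v))) \<noteq> 0"
    by (rule q_breve_nonzero[OF fin q S]) (use t s in \<open>auto simp: norm_mult intro!: mult_right_mono\<close>)
  then show False using t(3) by (simp only: q_breve_of_real) simp
qed

section \<open>Elementary inequalities for products\<close>

lemma prod_one_plus_ge:
  fixes f :: "'a \<Rightarrow> real"
  assumes "\<And>i. i \<in> I \<Longrightarrow> f i \<ge> 0"
  shows "1 + (\<Sum>i\<in>I. f i) \<le> (\<Prod>i\<in>I. 1 + f i)"
  using assms
proof (induction I rule: infinite_finite_induct)
  case (insert i I)
  have "1 + (f i + sum f I) \<le> (1 + f i) * (1 + sum f I)"
    using insert.prems by (auto simp: algebra_simps intro!: mult_nonneg_nonneg sum_nonneg)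
  also have "\<dots> \<le> (1 + f i) * (\<Prod>i\<in>I. 1 + f i)"
    using insert.prems by (intro mult_left_mono insert.IH) auto
  finally show ?case using insert.hyps by simp
qed auto

lemma norm_prod_le:
  fixes r :: "'a \<Rightarrow> complex" and b :: "'a \<Rightarrow> real"
  assumes "\<And>i. i \<in> I \<Longrightarrow> cmod (r i) \<le> b i"
  shows "cmod (\<Prod>i\<in>I. r i) \<le> (\<Prod>i\<in>I. b i)"
  unfolding prod_norm[symmetric] using assms by (intro prod_mono) auto

lemma norm_inverse_one_minus_le:
  fixes r :: complex
  assumes "cmod r \<le> b" "b < 1"
  shows "cmod (inverse (1 - r)) \<le> inverse (1 - b)"
proof -
  have "1 - b \<le> cmod (1 - r)" using norm_triangle_ineq2[of 1 r] assms by simp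
  then show ?thesis using assms by (simp add: norm_inverse le_imp_inverse_le)
qed

text \<open>The factors are exchanged one at a time. Each exchange costs |r - R| / (1 - b)^2, and
  one of the two denominators is absorbed into the common product.\<close>

lemma norm_diff_prod_inverse_le:
  fixes r R :: "'a \<Rightarrow> complex" and b :: "'a \<Rightarrow> real"
  assumes "finite I" and "\<And>i. i \<in> I \<Longrightarrow> cmod (r i) \<le> b i" "\<And>i. i \<in> I \<Longrightarrow> cmod (R i) \<le> b i"
    and "\<And>i. i \<in> I \<Longrightarrow> b i < 1"
  shows "cmod ((\<Prod>i\<in>I. inverse (1 - r i)) - (\<Prod>i\<in>I. inverse (1 - R i)))
    \<le> (\<Prod>i\<in>I. inverse (1 - b i)) * (\<Sum>i\<in>I. cmod (r i - R i) / (1 - b i))"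
  using assms
proof (induction I rule: finite_induct)
  case (insert j I)
  define B where "B = (\<Prod>i\<in>I. inverse (1 - b i))"
  define E where "E = (\<Sum>i\<in>I. cmod (r i - R i) / (1 - b i))"
  define P where "P = (\<Prod>i\<in>I. inverse (1 - r i))"
  define Q where "Q = (\<Prod>i\<in>I. inverse (1 - R i))"
  have IH: "cmod (P - Q) \<le> B * E" unfolding P_def Q_def B_def E_def
    by (rule insert.IH) (use insert.prems in auto)
  have Q: "cmod Q \<le> B" unfolding Q_def B_def
    by (rule norm_prod_le) (use insert.prems in \<open>auto intro: norm_inverse_one_minus_le\<close>)
  have bj: "b j < 1" and rj: "cmod (inverse (1 - r j)) \<le> inverse (1 - b j)"
    and Rj: "cmod (inverse (1 - R j)) \<le> inverse (1 - b j)"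
    using insert.prems by (auto intro!: norm_inverse_one_minus_le)
  have ne: "1 - r j \<noteq> 0" "1 - R j \<noteq> 0" using insert.prems(1-3)[of j] by auto
  have d: "inverse (1 - r j) - inverse (1 - R j) = inverse (1 - r j) * (r j - R j) * inverse (1 - R j)"
    using ne by (simp add: field_simps)
  have d': "cmod (inverse (1 - r j) - inverse (1 - R j))
      \<le> inverse (1 - b j) * cmod (r j - R j) * inverse (1 - b j)"
    unfolding d norm_mult using rj Rj bj by (intro mult_mono) auto
  \<comment> \<open>The mixed term \<open>inverse (1 - r j) * Q\<close> is subtracted and
    added.\<close>
  have "inverse (1 - r j) * P - inverse (1 - R j) * Q =
      inverse (1 - r j) * (P - Q) + (inverse (1 - r j) - inverse (1 - R j)) * Q"
    by (simp add: algebra_simps)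
  then have "cmod (inverse (1 - r j) * P - inverse (1 - R j) * Q) \<le>
      cmod (inverse (1 - r j)) * cmod (P - Q) + cmod (inverse (1 - r j) - inverse (1 - R j)) * cmod Q"
    by (metis norm_mult norm_triangle_ineq)
  also have "\<dots> \<le> inverse (1 - b j) * (B * E) + (inverse (1 - b j) * cmod (r j - R j) * inverse (1 - b j)) * B"
    using rj IH d' Q bj by (intro add_mono mult_mono) auto
  also have "\<dots> = (inverse (1 - b j) * B) * (cmod (r j - R j) / (1 - b j) + E)"
    by (simp add: algebra_simps divide_inverse)
  finally show ?case using insert.hyps by (simp add: B_def E_def P_def Q_def)
qed auto

text \<open>The contraction at one node: \<open>\<rho>, \<rho>'\<close> are the ratios at scales \<open>1\<close> and \<open>1 + \<alpha>\<close>, and \<open>X, Y\<close>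
  the sums of \<open>\<beta>\<^sub>c / (1 - \<rho>\<^sub>c)\<close> over the children at these scales.  With \<open>a = sqrt \<alpha>\<close> and
  \<open>y = 1 + X\<close> it rests on \<open>a\<^sup>2 y\<^sup>2 - a y + 1 + a > 0\<close>.\<close>

lemma contraction_ineq:
  fixes \<alpha> \<rho> \<rho>' X Y :: real
  assumes \<alpha>: "\<alpha> > 0" and \<rho>: "\<rho> \<ge> 0" and X: "X \<ge> 0" and Y: "Y \<ge> 0"
    and le: "\<rho> + \<alpha> * (\<rho> * (1 + X)) \<le> \<rho>'"
  shows "\<rho> * sqrt (X * Y) \<le> sqrt ((\<rho> * (1 + X)) * (\<rho>' * (1 + Y))) / sqrt (1 + sqrt \<alpha>)"
proof -
  define a where "a = sqrt \<alpha>"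
  have a: "a > 0" "\<alpha> = a * a" using \<alpha> by (auto simp: a_def)
  have "(1 + X) * (1 + \<alpha> * (1 + X)) - X * (1 + a) = (a * (1 + X) - 1 / 2)\<^sup>2 + 3 / 4 + a"
    unfolding a(2) by (simp add: power2_eq_square algebra_simps)
  also have "\<dots> \<ge> 0" using a(1) by simp
  finally have key: "X * (1 + a) \<le> (1 + X) * (1 + \<alpha> * (1 + X))" by simp
  have "\<rho>\<^sup>2 * (X * Y) * (1 + a) = (\<rho> * \<rho>) * ((X * (1 + a)) * Y)"
    by (simp add: power2_eq_square algebra_simps)
  also have "\<dots> \<le> (\<rho> * \<rho>) * (((1 + X) * (1 + \<alpha> * (1 + X))) * (1 + Y))"
    using key X Y a \<rho> by (intro mult_left_mono mult_mono[OF key]) auto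
  also have "\<dots> = (\<rho> * (1 + X)) * ((\<rho> + \<alpha> * (\<rho> * (1 + X))) * (1 + Y))"
    by (simp add: algebra_simps)
  also have "\<dots> \<le> (\<rho> * (1 + X)) * (\<rho>' * (1 + Y))"
    using le \<rho> X Y by (intro mult_left_mono mult_right_mono) auto
  finally have "sqrt (\<rho>\<^sup>2 * (X * Y) * (1 + a)) \<le> sqrt ((\<rho> * (1 + X)) * (\<rho>' * (1 + Y)))" by simp
  moreover have "sqrt (\<rho>\<^sup>2 * (X * Y) * (1 + a)) = \<rho> * sqrt (X * Y) * sqrt (1 + a)"
    using \<rho> by (simp add: real_sqrt_mult)
  moreover have "sqrt (1 + a) > 0" using a by simp
  ultimately show ?thesis unfolding a_def[symmetric] by (simp add: pos_le_divide_eq)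
qed

section \<open>Occupation ratios and sensitivities along the ray s|p|\<close>

locale scaled_shearer = pair_graph G
  for G :: "'a pair_pre_digraph" +
  fixes ws :: "'a set \<Rightarrow> 'a \<Rightarrow> 'a list" and p :: "'a \<Rightarrow> complex" and M :: real
  assumes ord: "nbr_ordering G ws"
    and region: "(\<lambda>v. complex_of_real M * p v) \<in> shearer_region G"
    and M_gt: "M > 1"
begin

definition rho :: "'a set \<Rightarrow> 'a \<Rightarrow> real \<Rightarrow> real" where
  "rho S u s = occ_ratio G S u (\<lambda>v. s * cmod (p v))"

text \<open>By the chain rule this is the derivative at t = 0 of
  \<open>rho S u ((1 + t) * s)\<close>, that is, the error sensitivity at s p for 0 < s < M.\<close>

definition beta :: "'a set \<Rightarrow> 'a \<Rightarrow> real \<Rightarrow> real" where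
  "beta S u s = s * deriv (rho S u) s"

lemmas child_node = child_props[OF ord]

lemma pos:
  assumes "S \<subseteq> pverts G" "0 \<le> s" "s \<le> M"
  shows "q_breve G S (\<lambda>v. s * cmod (p v)) > 0"
  by (rule q_breve_pos[OF pair_finite_verts region assms])

lemma rho_less_1:
  assumes "S \<subseteq> pverts G" "0 \<le> s" "s \<le> M"
  shows "rho S u s < 1"
proof -
  have "S - {u} \<subseteq> pverts G" using assms by auto
  from pos[OF this assms(2,3)] pos[OF assms] show ?thesis by (simp add: rho_def occ_ratio_def)
qed

lemma rho_rec:
  assumes "S \<subseteq> pverts G" "u \<in> S" "0 \<le> s" "s \<le> M"
  shows "rho S u s = s * cmod (p u) *
    (\<Prod>i<length (ws S u). inverse (1 - rho (child_set ws S u i) (ws S u ! i) s))"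
  unfolding rho_def
  by (rule occ_ratio_rec[OF ord assms(1,2)]) (simp add: pos[OF _ assms(3,4)] less_imp_neq[THEN not_sym])

lemma child_rho_less_1:
  assumes "S \<subseteq> pverts G" "u \<in> S" "0 \<le> s" "s \<le> M" "i < length (ws S u)"
  shows "rho (child_set ws S u i) (ws S u ! i) s < 1"
  using child_node(1)[OF assms(1,2,5)] assms(3,4) by (rule rho_less_1)

lemma rho_nonneg:
  assumes "S \<subseteq> pverts G" "u \<in> S" "0 \<le> s" "s \<le> M"
  shows "rho S u s \<ge> 0"
proof -
  show ?thesis unfolding rho_rec[OF assms] using assms(3) child_rho_less_1[OF assms]
    by (intro mult_nonneg_nonneg prod_nonneg) (auto simp: less_imp_le)
qed

text \<open>As a function of s the ratio is rational with nonzero denominator, so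
  \<open>deriv\<close> is a genuine derivative in the interior of the scale range.\<close>

lemma rho_deriv:
  assumes "S \<subseteq> pverts G" "0 < s" "s < M"
  shows "(rho S u has_real_derivative deriv (rho S u) s) (at s)"
proof -
  have d: "(\<lambda>s. q_breve G T (\<lambda>v. s * cmod (p v))) field_differentiable at s" for T
  proof -
    have "(\<lambda>s. \<Prod>v\<in>I. s * cmod (p v)) field_differentiable at s" for I
      unfolding field_differentiable_def
      by (rule exI, rule has_field_derivative_prod[where f' = "\<lambda>v. cmod (p v)"])
        (auto intro!: derivative_eq_intros)
    then show ?thesis unfolding q_breve_def
      by (intro field_differentiable_sum field_differentiable_mult field_differentiable_const)
  qed
  have "S - {u} \<subseteq> pverts G" using assms by auto
  from pos[OF this, of s] have "q_breve G (S - {u}) (\<lambda>v. s * cmod (p v)) \<noteq> 0" using assms by auto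
  then have "rho S u field_differentiable at s" unfolding rho_def occ_ratio_def
    by (intro field_differentiable_diff field_differentiable_divide field_differentiable_const d)
  then show ?thesis using field_differentiable_derivI by blast
qed

lemma err_sens_eq:
  assumes "S \<subseteq> pverts G" "0 < s" "s < M"
  shows "err_sens G S u (\<lambda>v. complex_of_real s * p v) = beta S u s"
proof -
  have "((\<lambda>t. rho S u ((1 + t) * s)) has_real_derivative deriv (rho S u) s * s) (at 0)"
    using rho_deriv[OF assms, of u] by (intro DERIV_chain2[of "rho S u"]) (auto intro!: derivative_eq_intros)
  then have "((\<lambda>t. abs_occ_ratio G S u (\<lambda>v. complex_of_real (1 + t) * (complex_of_real s * p v)))
      has_real_derivative deriv (rho S u) s * s) (at 0)"
  proof (rule has_field_derivative_transform_within_open[OF _ open_greaterThan[of "-1"]])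
    \<comment> \<open>The modulus of 1 + t is 1 + t only for t \<ge> -1; an open neighbourhood of 0
      suffices for the derivative.\<close>
    fix t :: real assume "t \<in> {-1<..}"
    then have "cmod (complex_of_real (1 + t) * (complex_of_real s * p v)) = (1 + t) * s * cmod (p v)" for v
      using assms(2) by (simp only: norm_mult norm_of_real) simp
    then show "rho S u ((1 + t) * s) =
        abs_occ_ratio G S u (\<lambda>v. complex_of_real (1 + t) * (complex_of_real s * p v))"
      by (simp add: rho_def abs_occ_ratio_def)
  qed simp
  then show ?thesis unfolding err_sens_def beta_def by (simp add: DERIV_imp_deriv)
qed

text \<open>The product rule is applied to the recursion of \<open>rho\<close> itself and not to its
  logarithm, since \<open>rho\<close> vanishes when \<open>p u\<close> = 0. Only the factors 1 / (1
  - rho_c), which are nonzero, are differentiated logarithmically.\<close>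

lemma beta_rec:
  assumes S: "S \<subseteq> pverts G" "u \<in> S" and s: "0 < s" "s < M"
  shows "beta S u s = rho S u s * (1 + (\<Sum>i<length (ws S u).
    beta (child_set ws S u i) (ws S u ! i) s / (1 - rho (child_set ws S u i) (ws S u ! i) s)))"
proof -
  let ?k = "length (ws S u)"
  let ?r = "\<lambda>i. rho (child_set ws S u i) (ws S u ! i)"
  let ?d = "\<lambda>i. deriv (?r i) s"
  let ?P = "\<lambda>s. \<Prod>i<?k. inverse (1 - ?r i s)"
  have lt: "?r i s < 1" if "i < ?k" for i
    using s that by (intro child_rho_less_1[OF S]) auto
  have "((\<lambda>s. inverse (1 - ?r i s)) has_real_derivative ?d i / (1 - ?r i s)\<^sup>2) (at s)" if "i < ?k" for i
    using lt[OF that] rho_deriv[OF child_node(1)[OF S that] s]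
    by (auto intro!: derivative_eq_intros simp: field_simps power2_eq_square)
  then have "(?P has_real_derivative ?P s * (\<Sum>i<?k. ?d i / (1 - ?r i s)\<^sup>2 / inverse (1 - ?r i s))) (at s)"
    using lt by (intro has_field_derivative_prod') force+
  also have "(\<Sum>i<?k. ?d i / (1 - ?r i s)\<^sup>2 / inverse (1 - ?r i s)) = (\<Sum>i<?k. ?d i / (1 - ?r i s))"
  proof (rule sum.cong[OF refl])
    fix i assume "i \<in> {..<?k}"
    then have "1 - ?r i s \<noteq> 0" using lt[of i] by simp
    then show "?d i / (1 - ?r i s)\<^sup>2 / inverse (1 - ?r i s) = ?d i / (1 - ?r i s)"
      by (simp add: divide_inverse power2_eq_square)
  qed
  finally have P: "(?P has_real_derivative ?P s * (\<Sum>i<?k. ?d i / (1 - ?r i s))) (at s)" .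
  have "((\<lambda>s. s * cmod (p u) * ?P s) has_real_derivative
      cmod (p u) * ?P s + s * cmod (p u) * (?P s * (\<Sum>i<?k. ?d i / (1 - ?r i s)))) (at s)"
    by (rule derivative_eq_intros P refl)+ simp
  \<comment> \<open>The recursion holds on the whole open interval (0, M), so both sides have the
    same derivative at s.\<close>
  moreover have "((\<lambda>s. s * cmod (p u) * ?P s) has_real_derivative deriv (rho S u) s) (at s)"
    by (rule has_field_derivative_transform_within_open[OF rho_deriv[OF S(1) s] open_greaterThanLessThan[of 0 M]])
       (use s rho_rec[OF S] in auto)
  ultimately have "deriv (rho S u) s =
      cmod (p u) * ?P s + s * cmod (p u) * (?P s * (\<Sum>i<?k. ?d i / (1 - ?r i s)))"
    using DERIV_unique by blast
  then have "beta S u s = s * cmod (p u) * ?P s * (1 + s * (\<Sum>i<?k. ?d i / (1 - ?r i s)))"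
    unfolding beta_def by (simp add: algebra_simps)
  then show ?thesis using rho_rec[OF S, of s] s by (simp add: beta_def sum_distrib_left)
qed

section \<open>Positivity and growth of the ratios in the scale\<close>

lemma beta_ge_rho:
  assumes s: "0 < s" "s < M" and S: "S \<subseteq> pverts G" "u \<in> S"
  shows "rho S u s \<le> beta S u s \<and> 0 \<le> beta S u s"
  using ord S
proof (induction rule: child_induct)
  case (node S u)
  let ?x = "\<lambda>i. beta (child_set ws S u i) (ws S u ! i) s / (1 - rho (child_set ws S u i) (ws S u ! i) s)"
  \<comment> \<open>Nonnegativity of the children's \<open>beta\<close> is part of the induction
    claim; it makes the bracket in \<open>beta_rec\<close> at least 1.\<close>
  have "?x i \<ge> 0" if "i < length (ws S u)" for i
    using node(3)[OF that] child_rho_less_1[OF node(1,2) _ _ that, of s] s by (intro divide_nonneg_nonneg) auto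
  then have "(\<Sum>i<length (ws S u). ?x i) \<ge> 0" by (intro sum_nonneg) auto
  moreover have "rho S u s \<ge> 0" using rho_nonneg node(1,2) s by auto
  ultimately show ?case unfolding beta_rec[OF node(1,2) s] by (auto simp: algebra_simps)
qed

text \<open>Working with the recursions for \<open>rho\<close> and \<open>beta\<close> avoids second derivatives.\<close>

lemma rho_above_tangent:
  assumes s: "0 < s" and t: "0 \<le> t" "(1 + t) * s < M" and S: "S \<subseteq> pverts G" "u \<in> S"
  shows "rho S u s + t * beta S u s \<le> rho S u ((1 + t) * s)"
  using ord S
proof (induction rule: child_induct)
  case (node S u)
  let ?k = "length (ws S u)"
  let ?r = "\<lambda>i. rho (child_set ws S u i) (ws S u ! i)"
  let ?b = "\<lambda>i. beta (child_set ws S u i) (ws S u ! i) s"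
  let ?s = "(1 + t) * s"
  have sM: "s < M" using s t by (smt (verit) mult_le_cancel_right1)
  have s': "0 < ?s" using s t by simp
  have fac: "0 \<le> 1 + t * (?b i / (1 - ?r i s)) \<and>
      inverse (1 - ?r i s) * (1 + t * (?b i / (1 - ?r i s))) \<le> inverse (1 - ?r i ?s)" if i: "i < ?k" for i
  proof -
    note c = child_node[OF node(1,2) i]
    define x where "x = 1 - ?r i s"
    define b where "b = t * ?b i"
    have x: "x > 0" unfolding x_def using child_rho_less_1[OF node(1,2) _ _ i, of s] s sM by auto
    have y: "1 - ?r i ?s > 0" using child_rho_less_1[OF node(1,2) _ _ i, of ?s] s' t by auto
    have b: "b \<ge> 0" unfolding b_def using beta_ge_rho[OF s sM c(1,2)] t by auto
    have le: "1 - ?r i ?s \<le> x - b" using node(3)[OF i] by (simp add: x_def b_def)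
    \<comment> \<open>Since (x + b)(x - b) \<le> x^2, the induction hypothesis yields the tangent
      bound for the reciprocal, with slope b / x^2.\<close>
    have "(x + b) * (1 - ?r i ?s) \<le> (x + b) * (x - b)" using x b le by (intro mult_left_mono) auto
    also have "\<dots> \<le> x * x" by (simp add: algebra_simps)
    finally have "inverse x * (1 + b / x) \<le> inverse (1 - ?r i ?s)" using x y by (simp add: field_simps)
    then show ?thesis using x b t by (simp add: x_def b_def)
  qed
  have nn: "?b i / (1 - ?r i s) \<ge> 0" if i: "i < ?k" for i
    using beta_ge_rho[OF s sM child_node(1,2)[OF node(1,2) i]] child_rho_less_1[OF node(1,2) _ _ i, of s] s sM
    by (intro divide_nonneg_nonneg) auto
  let ?X = "\<Sum>i<?k. ?b i / (1 - ?r i s)"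
  have X: "?X \<ge> 0" using nn by (intro sum_nonneg) auto
  have r0: "rho S u s \<ge> 0" using rho_nonneg node(1,2) s sM by auto
  \<comment> \<open>The dropped term is t^2 X. The factor 1 + t comes from the leading s in
    \<open>rho_rec\<close>, and Bernoulli's inequality for products then treats the
    children.\<close>
  have "1 + t * (1 + ?X) \<le> (1 + t) * (1 + t * ?X)" using t X by (simp add: algebra_simps)
  also have "\<dots> \<le> (1 + t) * (\<Prod>i<?k. 1 + t * (?b i / (1 - ?r i s)))"
    unfolding sum_distrib_left using t nn by (intro mult_left_mono prod_one_plus_ge mult_nonneg_nonneg) auto
  finally have "rho S u s * (1 + t * (1 + ?X)) \<le>
     rho S u s * ((1 + t) * (\<Prod>i<?k. 1 + t * (?b i / (1 - ?r i s))))" using r0 by (rule mult_left_mono)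
  also have "\<dots> = ?s * cmod (p u) * (\<Prod>i<?k. inverse (1 - ?r i s) * (1 + t * (?b i / (1 - ?r i s))))"
    using rho_rec[OF node(1,2), of s] s sM by (simp add: prod.distrib)
  also have "\<dots> \<le> ?s * cmod (p u) * (\<Prod>i<?k. inverse (1 - ?r i ?s))"
  proof (intro mult_left_mono prod_mono conjI)
    fix i assume "i \<in> {..<?k}"
    then have i: "i < ?k" by simp
    show "0 \<le> inverse (1 - ?r i s) * (1 + t * (?b i / (1 - ?r i s)))"
      using fac[OF i] child_rho_less_1[OF node(1,2) _ _ i, of s] s sM by auto
    show "inverse (1 - ?r i s) * (1 + t * (?b i / (1 - ?r i s))) \<le> inverse (1 - ?r i ?s)"
      using fac[OF i] by blast
  qed (use s' in auto)
  also have "\<dots> = rho S u ?s" using rho_rec[OF node(1,2), of ?s] s' t by simp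
  finally show ?case using beta_rec[OF node(1,2) s sM] by (simp add: algebra_simps)
qed

lemma rho_mono:
  assumes s: "0 < s" and t: "0 \<le> t" "(1 + t) * s < M" and S: "S \<subseteq> pverts G" "u \<in> S"
  shows "rho S u s \<le> rho S u ((1 + t) * s)"
proof -
  have "s < M" using s t by (smt (verit) mult_le_cancel_right1)
  then have "0 \<le> t * beta S u s" using beta_ge_rho[OF s _ S] t(1) by simp
  then show ?thesis using rho_above_tangent[OF assms] by simp
qed

section \<open>Truncated estimates and propagation of errors\<close>

lemma estimate_rec:
  assumes "d < l"
  shows "estimate ws p l d S u = p u * (\<Prod>i<length (ws S u).
    inverse (1 - estimate ws p l (Suc d) (child_set ws S u i) (ws S u ! i)))"
  using assms prod.distinct_set_conv_list[of "[0..<length (ws S u)]"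
    "\<lambda>i. inverse (1 - estimate ws p l (Suc d) (child_set ws S u i) (ws S u ! i))"]
  by (subst estimate.simps) (simp add: children_conv o_def atLeast0LessThan)

text \<open>One step of majorisation by the ratio of |p|. The values \<open>f\<close> at the
  children are arbitrary, so the step applies to exact ratios and to estimates alike.\<close>

lemma norm_le_rho_rec:
  assumes S: "S \<subseteq> pverts G" "u \<in> S"
    and le: "\<And>i. i < length (ws S u) \<Longrightarrow> cmod (f i) \<le> rho (child_set ws S u i) (ws S u ! i) 1"
  shows "cmod (p u * (\<Prod>i<length (ws S u). inverse (1 - f i))) \<le> rho S u 1"
proof -
  have "cmod (\<Prod>i<length (ws S u). inverse (1 - f i)) \<le>
    (\<Prod>i<length (ws S u). inverse (1 - rho (child_set ws S u i) (ws S u ! i) 1))"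
    using le child_rho_less_1[OF S, of 1] M_gt
    by (intro norm_prod_le norm_inverse_one_minus_le) auto
  then show ?thesis using rho_rec[OF S, of 1] M_gt by (simp add: norm_mult mult_left_mono)
qed

lemma occ_ratio_p_rec:
  assumes "S \<subseteq> pverts G" "u \<in> S"
  shows "occ_ratio G S u p = p u *
    (\<Prod>i<length (ws S u). inverse (1 - occ_ratio G (child_set ws S u i) (ws S u ! i) p))"
  by (rule occ_ratio_rec[OF ord assms], rule q_breve_nonzero[OF pair_finite_verts region])
     (use M_gt in \<open>auto simp: norm_mult mult_le_cancel_right1\<close>)

lemma norm_occ_ratio_le:
  assumes "S \<subseteq> pverts G" "u \<in> S"
  shows "cmod (occ_ratio G S u p) \<le> rho S u 1"
  using ord assms
proof (induction rule: child_induct)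
  case (node S u)
  show ?case unfolding occ_ratio_p_rec[OF node(1,2)] by (rule norm_le_rho_rec[OF node])
qed

lemma norm_estimate_le:
  assumes "S \<subseteq> pverts G" "u \<in> S"
  shows "cmod (estimate ws p l d S u) \<le> rho S u 1"
proof -
  \<comment> \<open>The depth is quantified inside the induction because it grows by one at each
    child, whereas the bound does not depend on it.\<close>
  have "\<forall>d. cmod (estimate ws p l d S u) \<le> rho S u 1"
    using ord assms
  proof (induction rule: child_induct)
    case (node S u)
    show ?case
    proof
      fix d
      show "cmod (estimate ws p l d S u) \<le> rho S u 1"
      proof (cases "d < l")
        case True
        show ?thesis unfolding estimate_rec[OF True]
          by (rule norm_le_rho_rec[OF node(1,2)]) (use node(3) in blast)
      next
        case False
        then show ?thesis using rho_nonneg[OF node(1,2), of 1] M_gt by (simp add: estimate.simps)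
      qed
    qed
  qed
  then show ?thesis by blast
qed

text \<open>Exact ratios and estimates obey the same recursion and share the majorant
  \<open>rho\<close> at scale 1. The prefactor of \<open>norm_diff_prod_inverse_le\<close> times
  |\<open>p u\<close>| is again \<open>rho\<close> at the parent.\<close>

lemma error_rec:
  assumes S: "S \<subseteq> pverts G" "u \<in> S" and "d < l"
  shows "cmod (occ_ratio G S u p - estimate ws p l d S u) \<le> rho S u 1 *
    (\<Sum>i<length (ws S u). cmod (occ_ratio G (child_set ws S u i) (ws S u ! i) p -
      estimate ws p l (Suc d) (child_set ws S u i) (ws S u ! i)) /
      (1 - rho (child_set ws S u i) (ws S u ! i) 1))"
proof -
  let ?k = "length (ws S u)"
  let ?b = "\<lambda>i. rho (child_set ws S u i) (ws S u ! i) 1"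
  let ?r = "\<lambda>i. occ_ratio G (child_set ws S u i) (ws S u ! i) p"
  let ?R = "\<lambda>i. estimate ws p l (Suc d) (child_set ws S u i) (ws S u ! i)"
  have "cmod (occ_ratio G S u p - estimate ws p l d S u) =
    cmod (p u) * cmod ((\<Prod>i<?k. inverse (1 - ?r i)) - (\<Prod>i<?k. inverse (1 - ?R i)))"
    unfolding occ_ratio_p_rec[OF S] estimate_rec[OF assms(3)]
    by (simp add: right_diff_distrib[symmetric] norm_mult)
  also have "\<dots> \<le> cmod (p u) * ((\<Prod>i<?k. inverse (1 - ?b i)) * (\<Sum>i<?k. cmod (?r i - ?R i) / (1 - ?b i)))"
    using norm_occ_ratio_le[OF child_node(1,2)[OF S]] norm_estimate_le[OF child_node(1,2)[OF S]]
      child_rho_less_1[OF S, of 1] M_gt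
    by (intro mult_left_mono norm_diff_prod_inverse_le) auto
  also have "\<dots> = rho S u 1 * (\<Sum>i<?k. cmod (?r i - ?R i) / (1 - ?b i))"
    using rho_rec[OF S, of 1] M_gt by simp
  finally show ?thesis .
qed

text \<open>At the cut-off depth the error is |r| itself, which is below the weight sqrt(beta(1)
  beta(1 + \<alpha>)). At every level above, \<open>error_rec\<close>, Cauchy-Schwarz and
  \<open>contraction_ineq\<close> gain one factor 1 / sqrt(1 + sqrt \<alpha>).\<close>

lemma error_bound:
  assumes \<alpha>: "\<alpha> > 0" "1 + \<alpha> < M" and S: "S \<subseteq> pverts G" "u \<in> S" and d: "d \<le> l"
  shows "cmod (occ_ratio G S u p - estimate ws p l d S u)
    \<le> sqrt (beta S u 1 * beta S u (1 + \<alpha>)) * (1 + sqrt \<alpha>) powr (- (real l - real d) / 2)"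
  using ord S d
proof (induction arbitrary: d rule: child_induct)
  case (node S u)
  let ?k = "length (ws S u)"
  let ?T = "child_set ws S u" and ?w = "\<lambda>i. ws S u ! i"
  let ?a = "1 + \<alpha>"
  have rho0: "0 \<le> rho S u 1" using rho_nonneg[OF node(1,2)] M_gt by simp
  have beta1: "rho S u 1 \<le> beta S u 1" "0 \<le> beta S u 1"
    using beta_ge_rho[of 1] node(1,2) M_gt by auto
  have beta2: "rho S u ?a \<le> beta S u ?a" "0 \<le> beta S u ?a"
    using beta_ge_rho[of ?a] node(1,2) \<alpha> by auto
  have tangent: "rho S u 1 + \<alpha> * beta S u 1 \<le> rho S u ?a"
    using rho_above_tangent[of 1 \<alpha>] node(1,2) \<alpha> by simp
  have rho_le: "rho S u 1 \<le> rho S u ?a"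
    using rho_mono[of 1 \<alpha>] node(1,2) \<alpha> by simp
  show ?case
  proof (cases "d = l")
    case True
    \<comment> \<open>One factor is bounded at scale 1, the other after moving to scale 1 + \<alpha>
      by monotonicity.\<close>
    have "rho S u 1 * rho S u 1 \<le> beta S u 1 * beta S u ?a"
      using rho0 beta1 beta2 rho_le by (intro mult_mono) auto
    then have "rho S u 1 \<le> sqrt (beta S u 1 * beta S u ?a)"
      using real_le_rsqrt[of "rho S u 1"] by (simp add: power2_eq_square)
    moreover have "1 + sqrt \<alpha> > 0" using \<alpha> by (simp add: add_pos_pos)
    ultimately show ?thesis
      using norm_occ_ratio_le[OF node(1,2)] True by (simp add: estimate.simps)
  next
    case False
    then have dl: "d < l" using node(4) by simp
    define c where "c = (1 + sqrt \<alpha>) powr (- (real l - real (Suc d)) / 2)"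
    define X where "X = (\<Sum>i<?k. beta (?T i) (?w i) 1 / (1 - rho (?T i) (?w i) 1))"
    define Y where "Y = (\<Sum>i<?k. beta (?T i) (?w i) ?a / (1 - rho (?T i) (?w i) ?a))"
    let ?x = "\<lambda>i. beta (?T i) (?w i) 1 / (1 - rho (?T i) (?w i) 1)"
    \<comment> \<open>The scales are mixed: \<open>error_rec\<close> produces denominators at scale
      1. Passing to those at 1 + \<alpha>, as \<open>beta_rec\<close> requires, only enlarges the
      sum, because \<open>rho\<close> is increasing.\<close>
    let ?y = "\<lambda>i. beta (?T i) (?w i) ?a / (1 - rho (?T i) (?w i) 1)"
    have lt1: "rho (?T i) (?w i) 1 < 1" if "i < ?k" for i
      using child_rho_less_1[OF node(1,2) _ _ that, of 1] M_gt by simp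
    have x: "?x i \<ge> 0" if "i < ?k" for i
      using beta_ge_rho[of 1] child_node(1,2)[OF node(1,2) that] lt1[OF that] M_gt
      by (intro divide_nonneg_nonneg) auto
    have y: "?y i \<ge> 0" if "i < ?k" for i
      using beta_ge_rho[of ?a] child_node(1,2)[OF node(1,2) that] lt1[OF that] \<alpha>
      by (intro divide_nonneg_nonneg) auto
    have yY: "?y i \<le> beta (?T i) (?w i) ?a / (1 - rho (?T i) (?w i) ?a)" if i: "i < ?k" for i
    proof -
      note c = child_node[OF node(1,2) i]
      have b: "beta (?T i) (?w i) 1 \<ge> 0" "beta (?T i) (?w i) ?a \<ge> 0"
        using beta_ge_rho[of 1] beta_ge_rho[of ?a] c(1,2) M_gt \<alpha> by auto
      have "rho (?T i) (?w i) 1 \<le> rho (?T i) (?w i) ?a"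
        using rho_mono[of 1 \<alpha>] c(1,2) \<alpha> by simp
      moreover have "rho (?T i) (?w i) ?a < 1"
        using child_rho_less_1[OF node(1,2) _ _ i, of ?a] \<alpha> by simp
      ultimately show ?thesis using b by (intro divide_left_mono mult_pos_pos) auto
    qed
    have X: "X \<ge> 0" unfolding X_def using x by (intro sum_nonneg) auto
    have Yle: "(\<Sum>i<?k. ?y i) \<le> Y" unfolding Y_def using yY by (intro sum_mono) auto
    have Y: "Y \<ge> 0" using Yle y sum_nonneg[of "{..<?k}" ?y] by fastforce
    \<comment> \<open>As \<open>?x\<close> and \<open>?y\<close> share a denominator, each product
      of roots is the weight of a child divided by 1 - rho_c(1), exactly the term of the error
      recursion without the decay \<open>c\<close>.\<close>
    have "(\<Sum>i<?k. sqrt (?x i) * sqrt (?y i))\<^sup>2 \<le> (\<Sum>i<?k. (sqrt (?x i))\<^sup>2) * (\<Sum>i<?k. (sqrt (?y i))\<^sup>2)"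
      by (rule Cauchy_Schwarz_ineq_sum)
    also have "\<dots> = X * (\<Sum>i<?k. ?y i)" unfolding X_def using x y by simp
    also have "\<dots> \<le> X * Y" using X Yle by (rule mult_left_mono[rotated])
    finally have CS: "(\<Sum>i<?k. sqrt (?x i) * sqrt (?y i)) \<le> sqrt (X * Y)"
      by (rule real_le_rsqrt)
    have term_le: "cmod (occ_ratio G (?T i) (?w i) p - estimate ws p l (Suc d) (?T i) (?w i)) /
        (1 - rho (?T i) (?w i) 1) \<le> sqrt (?x i) * sqrt (?y i) * c" if i: "i < ?k" for i
    proof -
      define z where "z = 1 - rho (?T i) (?w i) 1"
      have z: "z > 0" using lt1[OF i] by (simp add: z_def)
      have "cmod (occ_ratio G (?T i) (?w i) p - estimate ws p l (Suc d) (?T i) (?w i)) / z \<le>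
          sqrt (beta (?T i) (?w i) 1 * beta (?T i) (?w i) ?a) * c / z"
        unfolding c_def using z dl by (intro divide_right_mono node(3)[OF i]) auto
      also have "\<dots> = sqrt (?x i) * sqrt (?y i) * c"
        unfolding z_def[symmetric] using z by (simp add: real_sqrt_mult real_sqrt_divide)
      finally show ?thesis by (simp add: z_def)
    qed
    have "cmod (occ_ratio G S u p - estimate ws p l d S u) \<le> rho S u 1 *
        (\<Sum>i<?k. cmod (occ_ratio G (?T i) (?w i) p - estimate ws p l (Suc d) (?T i) (?w i)) /
          (1 - rho (?T i) (?w i) 1))"
      by (rule error_rec[OF node(1,2) dl])
    also have "\<dots> \<le> rho S u 1 * (\<Sum>i<?k. sqrt (?x i) * sqrt (?y i) * c)"
      using term_le rho0 by (intro mult_left_mono sum_mono) auto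
    also have "\<dots> \<le> rho S u 1 * (sqrt (X * Y) * c)"
      unfolding sum_distrib_right[symmetric] using CS rho0
      by (intro mult_left_mono mult_right_mono) (auto simp: c_def)
    also have "\<dots> \<le> sqrt (beta S u 1 * beta S u ?a) / sqrt (1 + sqrt \<alpha>) * c"
    proof -
      have bX: "beta S u 1 = rho S u 1 * (1 + X)"
        unfolding X_def using M_gt by (intro beta_rec[OF node(1,2)]) auto
      have bY: "beta S u ?a = rho S u ?a * (1 + Y)"
        unfolding Y_def using \<alpha> by (intro beta_rec[OF node(1,2)]) auto
      have "rho S u 1 * sqrt (X * Y) \<le> sqrt (beta S u 1 * beta S u ?a) / sqrt (1 + sqrt \<alpha>)"
        unfolding bX bY using contraction_ineq[OF \<alpha>(1) rho0 X Y] tangent bX by simp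
      then show ?thesis using mult_right_mono[of _ _ c] by (fastforce simp: c_def mult.assoc)
    qed
    also have "\<dots> = sqrt (beta S u 1 * beta S u ?a) * (1 + sqrt \<alpha>) powr (- (real l - real d) / 2)"
    proof -
      have pos: "1 + sqrt \<alpha> > 0" using \<alpha> by (simp add: add_pos_pos)
      \<comment> \<open>Moving from depth d + 1 to d lowers the exponent by 1/2, which is the factor
        gained by the contraction.\<close>
      have "(1 + sqrt \<alpha>) powr (- (real l - real d) / 2) = (1 + sqrt \<alpha>) powr (- (1 / 2)) * c"
        unfolding c_def powr_add[symmetric] by (rule arg_cong) (simp add: diff_divide_distrib add_divide_distrib)
      also have "(1 + sqrt \<alpha>) powr (- (1 / 2)) = 1 / sqrt (1 + sqrt \<alpha>)"
        using pos by (simp only: powr_minus powr_half_sqrt less_imp_le) (simp add: inverse_eq_divide)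
      finally show ?thesis by simp
    qed
    finally show ?thesis .
  qed
qed

end

section \<open>The error bound at the nodes of the computation tree\<close>

theorem theorem3p7:
  fixes G :: "'a pair_pre_digraph"
    and \<alpha> :: real
    and p :: "'a \<Rightarrow> complex"
    and ws :: "'a set \<Rightarrow> 'a \<Rightarrow> 'a list"
    and A S :: "'a set"
    and a u :: 'a
    and l d :: nat
  assumes "pair_graph G"
    and "\<alpha> > 0"
    and "(\<lambda>v. complex_of_real ((1 + \<alpha>)\<^sup>2) * p v) \<in> shearer_region G"
    and "nbr_ordering G ws"
    and "A \<subseteq> pverts G"
    and "a \<in> A"
    and "tree_node ws A a d S u"
    and "d \<le> l"
  shows "cmod (occ_ratio G S u p - estimate ws p l d S u)
    \<le> sqrt (err_sens G S u p * err_sens G S u (\<lambda>v. complex_of_real (1 + \<alpha>) * p v))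
       * (1 + sqrt \<alpha>) powr (- (real l - real d) / 2)"
proof -
  \<comment> \<open>The square leaves room above 1 + \<alpha>, so that \<open>rho\<close> can be
    differentiated at both scales 1 and 1 + \<alpha>.\<close>
  define M where "M = (1 + \<alpha>)\<^sup>2"
  have \<alpha>M: "1 + \<alpha> < M" using assms(2) by (simp add: M_def power2_eq_square algebra_simps add_pos_pos)
  interpret scaled_shearer G ws p M
    using assms \<alpha>M unfolding scaled_shearer_def scaled_shearer_axioms_def M_def by simp
  \<comment> \<open>\<open>error_bound\<close> covers every pair with u in S and every depth up to
    l; the tree enters only through this invariant.\<close>
  from assms(7) have S: "S \<subseteq> pverts G \<and> u \<in> S"
  proof induction
    case root
    then show ?case using assms by simp
  next
    case (child d S u T w)
    then obtain i where "i < length (ws S u)" "T = child_set ws S u i" "w = ws S u ! i"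
      by (auto simp: children_conv)
    then show ?case using child_node(1,2)[of S u i] child.IH by blast
  qed
  have "err_sens G S u p = beta S u 1"
    using err_sens_eq[of S 1 u] S M_gt by simp
  moreover have "err_sens G S u (\<lambda>v. complex_of_real (1 + \<alpha>) * p v) = beta S u (1 + \<alpha>)"
    using S assms(2) \<alpha>M by (intro err_sens_eq) auto
  ultimately show ?thesis using error_bound[OF assms(2) \<alpha>M _ _ assms(8)] S by simp
qed

end
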